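(* In the sequent calculus $L2q$, the connective $@$ is not idempotent: for an atomic proposition $A$, with $Q_A=A\,\&\,A^\perp$, $$Q_A\,@\,Q_A\ \neq\ Q_A ,$$ that is, it is not the case that both sequents $Q_A\,@\,Q_A\vdash Q_A$ and $Q_A\vdash Q_A\,@\,Q_A$ are derivable.
   Context: The language of $L2q$ has atomic propositions $A,B,\dots$ together with, for each atomic $A$, a further atomic proposition $A^\perp$ (its primitive negation, with $A^{\perp\perp}=A$), and connectives $\&$ (additive conjunction), $\vee$ (additive disjunction), $\otimes$ (multiplicative conjunction), $\wp$ (multiplicative disjunction), $\neg$, $@$ (entanglement) and $\S$ (dual of $@$). For atomic $A$ write $Q_A=A\,\&\,A^\perp$. Two formulas $X,Y$ are equal, in symbols $X\doteq Y$, if both $X\vdash Y$ and $Y\vdash X$ are derivable. Sequents have the form $\Gamma\vdash\Delta$ with $\Gamma,\Delta$ finite (possibly empty) lists of formulas. In the rules below ("premises $\Rightarrow$ conclusion") $C,D$ are arbitrary formulas, and $A,B$ are atomic. Active formulas carry no side contexts other than those displayed. Identity: $C\vdash C$. $\&$: $\Gamma\vdash C$, $\Gamma\vdash D$ $\Rightarrow$ $\Gamma\vdash C\&D$; $C\vdash\Delta$ $\Rightarrow$ $C\&D\vdash\Delta$; $D\vdash\Delta$ $\Rightarrow$ $C\&D\vdash\Delta$. $\vee$: $C\vdash\Delta$, $D\vdash\Delta$ $\Rightarrow$ $C\vee D\vdash\Delta$; $\Gamma\vdash C$ $\Rightarrow$ $\Gamma\vdash C\vee D$; $\Gamma\vdash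 D$ $\Rightarrow$ $\Gamma\vdash C\vee D$. $\otimes$: $C,D\vdash\Delta$ $\Rightarrow$ $C\otimes D\vdash\Delta$; $\Gamma\vdash C$, $\Gamma'\vdash D$ $\Rightarrow$ $\Gamma,\Gamma'\vdash C\otimes D$. $\wp$: $\Gamma\vdash C,D$ $\Rightarrow$ $\Gamma\vdash C\wp D$; $C\vdash\Delta$, $D\vdash\Delta'$ $\Rightarrow$ $C\wp D\vdash\Delta,\Delta'$. $@$: $\Gamma\vdash A,B$ and $\Gamma\vdash A^\perp,B^\perp$ $\Rightarrow$ $\Gamma\vdash Q_A@Q_B$; $A\vdash\Delta$, $B\vdash\Delta'$ $\Rightarrow$ $Q_A@Q_B\vdash\Delta,\Delta'$; $A^\perp\vdash\Delta$, $B^\perp\vdash\Delta'$ $\Rightarrow$ $Q_A@Q_B\vdash\Delta,\Delta'$. $\S$: $A,B\vdash\Delta$ and $A^\perp,B^\perp\vdash\Delta$ $\Rightarrow$ $Q_A\S Q_B\vdash\Delta$; $\Gamma\vdash A$, $\Gamma'\vdash B$ $\Rightarrow$ $\Gamma,\Gamma'\vdash Q_A\S Q_B$; $\Gamma\vdash A^\perp$, $\Gamma'\vdash B^\perp$ $\Rightarrow$ $\Gamma,\Gamma'\vdash Q_A\S Q_B$. $\neg$: $C\vdash$ $\Rightarrow$ $\vdash\neg C$; $\vdash C$ $\Rightarrow$ $\neg C\vdash$. Cut: $\Gamma\vdash C$, $C\vdash\Delta$ $\Rightarrow$ $\Gamma\vdash\Delta$. EPR rule: $\Gamma\vdash Q_A@Q_B$,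 $Q_A\vdash A$ $\Rightarrow$ $\Gamma\vdash A@Q_B$. There are no structural rules (no weakening, contraction or exchange). *)

theory Defs
  imports Main
begin

(* The primitive negation of an atomic proposition is again an atomic proposition, distinct from it.
   Accordingly, the variables A, B of type 'p atom in the rules range over Pos p and Neg p alike. *)
datatype 'p atom = Pos 'p | Neg 'p

fun perp :: "'p atom \<Rightarrow> 'p atom"  ("_\<^sup>\<bottom>" [1000] 1000) where
  "(Pos p)\<^sup>\<bottom> = Neg p"
| "(Neg p)\<^sup>\<bottom> = Pos p"

lemma perp_perp [simp]: "A\<^sup>\<bottom>\<^sup>\<bottom> = A"
  by (cases A) simp_all

(* @ and \<section> are total on formulas, since the EPR rule produces A @ Q_B with A atomic;
   the rules restrict how such formulas can be derived. *)
datatype 'p form =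
    Atom "'p atom"
  | AddConj "'p form" "'p form"   (infixr "\<^bold>&" 70)
  | AddDisj "'p form" "'p form"   (infixr "\<^bold>\<or>" 70)
  | MultConj "'p form" "'p form"  (infixr "\<^bold>\<otimes>" 70)
  | MultDisj "'p form" "'p form"  (infixr "\<wp>" 70)
  | Negation "'p form"                 ("\<^bold>\<not> _" [80] 80)
  | Ent "'p form" "'p form"       (infixr "\<^bold>@" 70)
  | DualEnt "'p form" "'p form"   (infixr "\<section>" 70)

definition Q :: "'p atom \<Rightarrow> 'p form" where
  "Q A = Atom A \<^bold>& Atom (A\<^sup>\<bottom>)"

inductive derivable :: "'p form list \<Rightarrow> 'p form list \<Rightarrow> bool"  (infix "\<turnstile>" 50) where
  identity: "[C] \<turnstile> [C]"
| and_right: "\<Gamma> \<turnstile> [C] \<Longrightarrow> \<Gamma> \<turnstile> [D] \<Longrightarrow> \<Gamma> \<turnstile> [C \<^bold>& D]"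
| and_left1: "[C] \<turnstile> \<Delta> \<Longrightarrow> [C \<^bold>& D] \<turnstile> \<Delta>"
| and_left2: "[D] \<turnstile> \<Delta> \<Longrightarrow> [C \<^bold>& D] \<turnstile> \<Delta>"
| or_left: "[C] \<turnstile> \<Delta> \<Longrightarrow> [D] \<turnstile> \<Delta> \<Longrightarrow> [C \<^bold>\<or> D] \<turnstile> \<Delta>"
| or_right1: "\<Gamma> \<turnstile> [C] \<Longrightarrow> \<Gamma> \<turnstile> [C \<^bold>\<or> D]"
| or_right2: "\<Gamma> \<turnstile> [D] \<Longrightarrow> \<Gamma> \<turnstile> [C \<^bold>\<or> D]"
| tensor_left: "[C, D] \<turnstile> \<Delta> \<Longrightarrow> [C \<^bold>\<otimes> D] \<turnstile> \<Delta>"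
| tensor_right: "\<Gamma> \<turnstile> [C] \<Longrightarrow> \<Gamma>' \<turnstile> [D] \<Longrightarrow> \<Gamma> @ \<Gamma>' \<turnstile> [C \<^bold>\<otimes> D]"
| par_right: "\<Gamma> \<turnstile> [C, D] \<Longrightarrow> \<Gamma> \<turnstile> [C \<wp> D]"
| par_left: "[C] \<turnstile> \<Delta> \<Longrightarrow> [D] \<turnstile> \<Delta>' \<Longrightarrow> [C \<wp> D] \<turnstile> \<Delta> @ \<Delta>'"
| ent_right: "\<Gamma> \<turnstile> [Atom A, Atom B] \<Longrightarrow> \<Gamma> \<turnstile> [Atom (A\<^sup>\<bottom>), Atom (B\<^sup>\<bottom>)] \<Longrightarrow> \<Gamma> \<turnstile> [Q A \<^bold>@ Q B]"
| ent_left1: "[Atom A] \<turnstile> \<Delta> \<Longrightarrow> [Atom B] \<turnstile> \<Delta>' \<Longrightarrow> [Q A \<^bold>@ Q B] \<turnstile> \<Delta> @ \<Delta>'"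
| ent_left2: "[Atom (A\<^sup>\<bottom>)] \<turnstile> \<Delta> \<Longrightarrow> [Atom (B\<^sup>\<bottom>)] \<turnstile> \<Delta>' \<Longrightarrow> [Q A \<^bold>@ Q B] \<turnstile> \<Delta> @ \<Delta>'"
| dual_left: "[Atom A, Atom B] \<turnstile> \<Delta> \<Longrightarrow> [Atom (A\<^sup>\<bottom>), Atom (B\<^sup>\<bottom>)] \<turnstile> \<Delta> \<Longrightarrow> [Q A \<section> Q B] \<turnstile> \<Delta>"
| dual_right1: "\<Gamma> \<turnstile> [Atom A] \<Longrightarrow> \<Gamma>' \<turnstile> [Atom B] \<Longrightarrow> \<Gamma> @ \<Gamma>' \<turnstile> [Q A \<section> Q B]"
| dual_right2: "\<Gamma> \<turnstile> [Atom (A\<^sup>\<bottom>)] \<Longrightarrow> \<Gamma>' \<turnstile> [Atom (B\<^sup>\<bottom>)] \<Longrightarrow> \<Gamma> @ \<Gamma>' \<turnstile> [Q A \<section> Q B]"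
| neg_right: "[C] \<turnstile> [] \<Longrightarrow> [] \<turnstile> [\<^bold>\<not> C]"
| neg_left: "[] \<turnstile> [C] \<Longrightarrow> [\<^bold>\<not> C] \<turnstile> []"
| cut: "\<Gamma> \<turnstile> [C] \<Longrightarrow> [C] \<turnstile> \<Delta> \<Longrightarrow> \<Gamma> \<turnstile> \<Delta>"
| epr: "\<Gamma> \<turnstile> [Q A \<^bold>@ Q B] \<Longrightarrow> [Q A] \<turnstile> [Atom A] \<Longrightarrow> \<Gamma> \<turnstile> [Atom A \<^bold>@ Q B]"

definition form_eq :: "'p form \<Rightarrow> 'p form \<Rightarrow> bool"  (infix "\<doteq>" 50) where
  "X \<doteq> Y \<longleftrightarrow> [X] \<turnstile> [Y] \<and> [Y] \<turnstile> [X]"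

end

theory Submission
  imports Defs
begin

text \<open>
  Since there is neither weakening nor contraction, and cut passes through a single formula without
  side contexts, the calculus admits an integer weight that never decreases from left to right of
  the turnstile: the additives are minimum and maximum, and the multiplicatives together with
  entanglement and its dual are sums. With every atom of weight 1, \<open>Q A\<close> has weight 1 but
  \<open>Q A \<^bold>@ Q A\<close> has weight 2.
\<close>

primrec weight :: "'p form \<Rightarrow> int" where
  "weight (Atom A) = 1"
| "weight (C \<^bold>& D) = min (weight C) (weight D)"
| "weight (C \<^bold>\<or> D) = max (weight C) (weight D)"
| "weight (C \<^bold>\<otimes> D) = weight C + weight D"
| "weight (C \<wp> D) = weight C + weight D"
| "weight (\<^bold>\<not> C) = - weight C"
| "weight (C \<^bold>@ D) = weight C + weight D"
| "weight (C \<section> D) = weight C + weight D"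

lemma weight_Q [simp]: "weight (Q A) = 1"
  by (simp add: Q_def)

text \<open>Cut is transitivity and rules that join contexts add inequalities. An empty side sums to
  0, so the sign change settles negation. The rules for entanglement, its dual and EPR hold because
  \<open>Q A\<close>, \<open>Atom A\<close> and the negated atom all weigh 1.\<close>

lemma derivable_weight_le:
  assumes "\<Gamma> \<turnstile> \<Delta>"
  shows "sum_list (map weight \<Gamma>) \<le> sum_list (map weight \<Delta>)"
  using assms by induction auto

theorem theorem11p1:
  fixes A :: "'p atom"
  shows "\<not> (Q A \<^bold>@ Q A \<doteq> Q A)"
proof
  assume "Q A \<^bold>@ Q A \<doteq> Q A"
  then have "[Q A \<^bold>@ Q A] \<turnstile> [Q A]"
    by (simp add: form_eq_def)
  \<comment> \<open>The bound would give 2 \<le> 1. The converse sequent only gives 1 \<le> 2, so it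
    could not be refuted this way.\<close>
  from derivable_weight_le [OF this] show False
    by simp
qed

end
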